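(* Let $K$ be a field, $d,n>1$ integers, $N=\binom{d+n-1}{d}$, and $v_d\colon K^n\to K^N$ the Veronese map. If $\mathcal U$ is a set of at least $d+1$ nonzero subspaces of $K^n$ pairwise intersecting in $0$, then $\{\langle v_d(U)\rangle\mid U\in\mathcal U\}$ is a $(d+1)$-independent set of subspaces of $K^N$: for any $d+1$ distinct $U_0,\dots,U_d\in\mathcal U$, the sum $\sum_i\langle v_d(U_i)\rangle$ is direct.
   Context: Fix an arbitrary ordering of all sequences $\alpha=(a_1,\dots,a_n)$ of nonnegative integers with $\sum_k a_k=d$; coordinates of $K^N$ are indexed by them. For $t\in K^n$, $t^\alpha=\prod_i t_i^{a_i}$ and $v_d(t)=(t^\alpha)_\alpha$. For a subspace $U$, $\langle v_d(U)\rangle$ is the span of $\{v_d(u)\mid u\in U\}$. A set of at least $k$ subspaces is $k$-independent if the span of any $k$ distinct members is their direct sum. *)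

theory Defs
  imports "HOL-Analysis.Cartesian_Space"
begin

text \<open>The exponent sequences of the monomials of degree \<open>d\<close> in variables indexed by \<open>'n\<close>.\<close>

definition exponents :: "nat \<Rightarrow> ('n::finite \<Rightarrow> nat) set" where
  "exponents d = {a. (\<Sum>k\<in>UNIV. a k) = d}"

text \<open>The argument \<open>e\<close> is the chosen ordering of the exponent sequences: when it is a bijection
  from \<open>'m\<close> onto \<open>exponents d\<close>, this is the Veronese map of degree \<open>d\<close>.\<close>

definition veronese :: "('m::finite \<Rightarrow> 'n::finite \<Rightarrow> nat) \<Rightarrow> 'a::field ^ 'n \<Rightarrow> 'a ^ 'm" where
  "veronese e t = (\<chi> k. \<Prod>i\<in>UNIV. t $ i ^ e k i)"

definition veronese_span ::
    "('m::finite \<Rightarrow> 'n::finite \<Rightarrow> nat) \<Rightarrow> ('a::field ^ 'n) set \<Rightarrow> ('a ^ 'm) set" where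
  "veronese_span e U = vec.span (veronese e ` U)"

text \<open>\<open>V\<close> is the internal direct sum of the finite family \<open>(W i)\<close>, \<open>i \<in> I\<close>: every element of \<open>V\<close>
  is a sum of members \<open>w i \<in> W i\<close> in exactly one way, and all such sums lie in \<open>V\<close>.\<close>

definition is_direct_sum :: "'i set \<Rightarrow> ('i \<Rightarrow> ('a::field ^ 'm::finite) set) \<Rightarrow> ('a ^ 'm) set \<Rightarrow> bool" where
  "is_direct_sum I W V \<longleftrightarrow>
     finite I \<and> bij_betw (\<lambda>w. \<Sum>i\<in>I. w i) (\<Pi>\<^sub>E i\<in>I. W i) V"

text \<open>The set \<open>S\<close> may be infinite, where \<open>card S\<close> would be \<open>0\<close>.\<close>

definition at_least :: "nat \<Rightarrow> 'b set \<Rightarrow> bool" where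
  "at_least k S \<longleftrightarrow> (finite S \<longrightarrow> k \<le> card S)"

definition k_independent :: "nat \<Rightarrow> ('a::field ^ 'm::finite) set set \<Rightarrow> bool" where
  "k_independent k S \<longleftrightarrow>
     (\<forall>W\<in>S. vec.subspace W) \<and> at_least k S \<and>
     (\<forall>F\<subseteq>S. finite F \<and> card F = k \<longrightarrow> is_direct_sum F (\<lambda>W. W) (vec.span (\<Union>F)))"

end

theory Submission
  imports Defs
begin

text \<open>A product of \<open>d\<close> linear forms is the composite of the Veronese map with a linear
  functional. Given \<open>U\<close> and \<open>d\<close> subspaces \<open>V\<^sub>j\<close> meeting \<open>U\<close> trivially, write a monomial of degree
  \<open>d\<close> as a product of coordinate forms and replace the \<open>j\<close>-th factor by a linear form that agrees with it
  on \<open>U\<close> and vanishes on \<open>V\<^sub>j\<close>. The resulting functional vanishes on each \<open>\<langle>v\<^sub>d(V\<^sub>j)\<rangle>\<close> and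
  agrees on \<open>\<langle>v\<^sub>d(U)\<rangle>\<close> with the coordinate of the monomial, so \<open>\<langle>v\<^sub>d(U)\<rangle>\<close> meets the sum of the
  \<open>\<langle>v\<^sub>d(V\<^sub>j)\<rangle>\<close> trivially.\<close>

section \<open>Linear forms prescribed on two subspaces\<close>

text \<open>Since \<open>U + V\<close> is direct, the map that is the identity on \<open>U\<close>
  and zero on \<open>V\<close> is well defined; extended to the whole space, its coordinate
  \<open>p\<close> is the required form.\<close>

lemma ex_coeffs_extending_zero:
  fixes U V :: "('a::field ^ 'n::finite) set"
  assumes U: "vec.subspace U" and V: "vec.subspace V" and UV: "U \<inter> V = {0}"
  shows "\<exists>b :: 'n \<Rightarrow> 'a. (\<forall>u\<in>U. (\<Sum>i\<in>UNIV. b i * u $ i) = u $ p) \<and>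
    (\<forall>v\<in>V. (\<Sum>i\<in>UNIV. b i * v $ i) = 0)"
proof -
  obtain B where B: "B \<subseteq> U" "vec.independent B" "U = vec.span B" "card B = vec.dim U"
    using vec.basis_exists[of U] U by (metis vec.span_subspace)
  obtain C where C: "C \<subseteq> V" "vec.independent C" "V = vec.span C" "card C = vec.dim V"
    using vec.basis_exists[of V] V by (metis vec.span_subspace)
  have fin: "finite B" "finite C"
    using B C vec.finiteI_independent by auto
  have "vec.dim {x + y |x y. x \<in> U \<and> y \<in> V} + vec.dim (U \<inter> V) = vec.dim U + vec.dim V"
    by (rule vec.dim_sums_Int[OF U V])
  moreover have "{x + y |x y. x \<in> U \<and> y \<in> V} = vec.span (B \<union> C)"
    by (simp add: vec.span_Un B(3) C(3))
  ultimately have "vec.dim (vec.span (B \<union> C)) = card B + card C"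
    by (simp add: UV B(4) C(4))
  \<comment> \<open>\<open>B \<union> C\<close> has at most \<open>card B + card C\<close> elements
    and spans a space of exactly that dimension.\<close>
  then have ind: "vec.independent (B \<union> C)"
    using fin card_Un_le[of B C]
    by (intro vec.card_le_dim_spanning[of _ "vec.span (B \<union> C)"]) (auto intro: vec.span_base)
  have disj: "B \<inter> C = {}"
  proof -
    have "0 \<notin> B"
      using B(2) vec.dependent_zero by auto
    moreover have "B \<inter> C \<subseteq> {0}"
      using Int_mono[OF B(1) C(1)] UV by simp
    ultimately show ?thesis
      by blast
  qed
  obtain f :: "'a ^ 'n \<Rightarrow> 'a ^ 'n" where
    f: "Vector_Spaces.linear (*s) (*s) f" "\<forall>x\<in>B \<union> C. f x = (if x \<in> B then x else 0)"
    using vec.linear_independent_extend[OF ind, of "\<lambda>x. if x \<in> B then x else 0"] by blast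
  have fU: "f u = u" if "u \<in> U" for u
  proof (rule vec.linear_eq_on[OF f(1) vec.linear_ident])
    show "u \<in> vec.span B" using that B(3) by blast
  qed (use f(2) in auto)
  have fV: "f v = 0" if "v \<in> V" for v
  proof (rule vec.linear_eq_0_on_span[OF f(1)])
    show "v \<in> vec.span C" using that C(3) by blast
  qed (use f(2) disj in auto)
  have "f x $ p = (\<Sum>i\<in>UNIV. matrix f $ p $ i * x $ i)" for x
    using matrix_works[OF f(1), of x] by (simp add: matrix_vector_mult_def vec_eq_iff)
  from this[symmetric] show ?thesis
    by (intro exI[of _ "\<lambda>i. matrix f $ p $ i"]) (simp add: fU fV)
qed

section \<open>Monomials and products of linear forms\<close>

text \<open>Counting how often \<open>f\<close> takes each value gives an exponent sequence of sum
  \<open>card J\<close>, and \<open>e\<close> reaches every such sequence.\<close>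

lemma veronese_prod_coordinates:
  fixes e :: "'m::finite \<Rightarrow> 'n::finite \<Rightarrow> nat" and f :: "'i \<Rightarrow> 'n"
  assumes "finite J" and "exponents (card J) \<subseteq> range e"
  shows "\<exists>k. \<forall>t :: 'a::field ^ 'n. veronese e t $ k = (\<Prod>j\<in>J. t $ f j)"
proof -
  define a where "a i = card {j\<in>J. f j = i}" for i
  have "(\<Sum>i\<in>UNIV. a i) = card J"
    using sum.group[OF assms(1) finite_class.finite_UNIV, of f "\<lambda>_. 1::nat"]
    by (simp add: a_def)
  then obtain k where k: "e k = a"
    using assms(2) by (auto simp: exponents_def)
  have "(\<Prod>i\<in>UNIV. t $ i ^ a i) = (\<Prod>j\<in>J. t $ f j)" for t :: "'a ^ 'n"
  proof -
    have "(\<Prod>j\<in>J. t $ f j) = (\<Prod>i\<in>UNIV. \<Prod>j\<in>{j\<in>J. f j = i}. t $ f j)"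
      using prod.group[OF assms(1) finite_class.finite_UNIV, of f "\<lambda>j. t $ f j"] by simp
    also have "\<dots> = (\<Prod>i\<in>UNIV. t $ i ^ a i)"
      by (intro prod.cong) (auto simp: a_def)
    finally show ?thesis by simp
  qed
  then show ?thesis
    using k by (auto simp: veronese_def)
qed

lemma ex_coordinates_prod_veronese:
  fixes e :: "'m::finite \<Rightarrow> 'n::finite \<Rightarrow> nat"
  assumes "k \<in> e -` exponents (card J)" and "finite J"
  shows "\<exists>f :: 'i \<Rightarrow> 'n. \<forall>t :: 'a::field ^ 'n. veronese e t $ k = (\<Prod>j\<in>J. t $ f j)"
proof -
  \<comment> \<open>\<open>S\<close> holds \<open>e k i\<close> copies of each variable
    \<open>i\<close>, so \<open>card J\<close> factors in all; a bijection from \<open>J\<close>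
    assigns one factor to each index.\<close>
  define S where "S = (SIGMA i:UNIV. {..<e k i})"
  have "card S = card J"
    using assms by (simp add: S_def exponents_def)
  moreover have "finite S"
    by (simp add: S_def)
  ultimately obtain g where g: "bij_betw g J S"
    using assms(2) finite_same_card_bij by metis
  have "(\<Prod>j\<in>J. t $ fst (g j)) = veronese e t $ k" for t :: "'a ^ 'n"
  proof -
    have "(\<Prod>j\<in>J. t $ fst (g j)) = (\<Prod>s\<in>S. t $ fst s)"
      by (rule prod.reindex_bij_betw[OF g])
    also have "\<dots> = (\<Prod>i\<in>UNIV. \<Prod>r\<in>{..<e k i}. t $ i)"
      unfolding S_def by (subst prod.Sigma) (auto simp: case_prod_unfold)
    finally show ?thesis
      by (simp add: veronese_def)
  qed
  then show ?thesis
    by (metis comp_apply)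
qed

text \<open>Multiplying out gives one monomial for each choice \<open>f\<close> of a variable in
  every factor, and each of these monomials is a Veronese coordinate.\<close>

lemma ex_functional_prod_linear_forms:
  fixes e :: "'m::finite \<Rightarrow> 'n::finite \<Rightarrow> nat" and b :: "'i \<Rightarrow> 'n \<Rightarrow> 'a::field"
  assumes J: "finite J" and e: "exponents (card J) \<subseteq> range e"
  shows "\<exists>c :: 'm \<Rightarrow> 'a. \<forall>t. (\<Sum>k\<in>UNIV. c k * veronese e t $ k) =
    (\<Prod>j\<in>J. \<Sum>i\<in>UNIV. b j i * t $ i)"
proof -
  let ?F = "J \<rightarrow>\<^sub>E (UNIV :: 'n set)"
  have "\<forall>f :: 'i \<Rightarrow> 'n. \<exists>k. \<forall>t :: 'a ^ 'n. veronese e t $ k = (\<Prod>j\<in>J. t $ f j)"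
    using veronese_prod_coordinates[OF assms] by blast
  then obtain \<kappa> where \<kappa>: "\<And>f (t :: 'a ^ 'n). veronese e t $ \<kappa> f = (\<Prod>j\<in>J. t $ f j)"
    by metis
  have F: "finite ?F"
    using J by (simp add: finite_PiE)
  \<comment> \<open>Different choices can yield the same monomial, so their coefficients are
    collected over the fibres of \<open>\<kappa>\<close>.\<close>
  define c where "c k = (\<Sum>f\<in>{f\<in>?F. \<kappa> f = k}. \<Prod>j\<in>J. b j (f j))" for k
  have "(\<Sum>k\<in>UNIV. c k * veronese e t $ k) = (\<Prod>j\<in>J. \<Sum>i\<in>UNIV. b j i * t $ i)"
    for t :: "'a ^ 'n"
  proof -
    have "(\<Prod>j\<in>J. \<Sum>i\<in>UNIV. b j i * t $ i) = (\<Sum>f\<in>?F. \<Prod>j\<in>J. b j (f j) * t $ f j)"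
      using J by (simp add: prod_sum_PiE)
    also have "\<dots> = (\<Sum>f\<in>?F. (\<Prod>j\<in>J. b j (f j)) * veronese e t $ \<kappa> f)"
      by (simp add: prod.distrib \<kappa>)
    also have "\<dots> = (\<Sum>k\<in>UNIV. \<Sum>f\<in>{f\<in>?F. \<kappa> f = k}.
        (\<Prod>j\<in>J. b j (f j)) * veronese e t $ \<kappa> f)"
      using sum.group[OF F finite_class.finite_UNIV, of \<kappa>
          "\<lambda>f. (\<Prod>j\<in>J. b j (f j)) * veronese e t $ \<kappa> f"] by simp
    also have "\<dots> = (\<Sum>k\<in>UNIV. c k * veronese e t $ k)"
      by (simp add: c_def sum_distrib_right)
    finally show ?thesis by simp
  qed
  then show ?thesis by blast
qed

lemma functional_eq_on_span:
  fixes c c' :: "'m::finite \<Rightarrow> 'a::field"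
  assumes "w \<in> vec.span S"
    and "\<And>x. x \<in> S \<Longrightarrow> (\<Sum>k\<in>UNIV. c k * x $ k) = (\<Sum>k\<in>UNIV. c' k * x $ k)"
  shows "(\<Sum>k\<in>UNIV. c k * w $ k) = (\<Sum>k\<in>UNIV. c' k * w $ k)"
  using assms(1)
proof (induction rule: vec.span_induct_alt)
  case base
  then show ?case by simp
next
  case (step a x y)
  have "(\<Sum>k\<in>UNIV. c k * (a *s x + y) $ k) =
      a * (\<Sum>k\<in>UNIV. c k * x $ k) + (\<Sum>k\<in>UNIV. c k * y $ k)" for c :: "'m \<Rightarrow> 'a"
    by (simp add: algebra_simps sum.distrib sum_distrib_left)
  then show ?case
    using step assms(2) by simp
qed

text \<open>Nothing is asked of the \<open>V j\<close> among themselves; they may even coincide,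
  which the injectivity of \<open>veronese_span\<close> exploits.\<close>

lemma veronese_span_inter_trivial:
  fixes e :: "'m::finite \<Rightarrow> 'n::finite \<Rightarrow> nat" and U :: "('a::field ^ 'n) set"
  assumes J: "finite J" and e: "range e = exponents (card J)"
    and U: "vec.subspace U" and V: "\<And>j. j \<in> J \<Longrightarrow> vec.subspace (V j)"
    and UV: "\<And>j. j \<in> J \<Longrightarrow> U \<inter> V j = {0}"
    and w: "w \<in> veronese_span e U" "w \<in> vec.span (\<Union>j\<in>J. veronese_span e (V j))"
  shows "w = 0"
proof -
  have "w $ k = 0" for k
  proof -
    obtain f where f: "\<And>t :: 'a ^ 'n. veronese e t $ k = (\<Prod>j\<in>J. t $ f j)"
      using ex_coordinates_prod_veronese[of k e J] e J by blast
    have "\<exists>b. \<forall>j\<in>J. (\<forall>u\<in>U. (\<Sum>i\<in>UNIV. b j i * u $ i) = u $ f j) \<and>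
        (\<forall>v\<in>V j. (\<Sum>i\<in>UNIV. b j i * v $ i) = 0)"
      by (intro bchoice ballI ex_coeffs_extending_zero U V UV)
    then obtain b where bU: "\<And>j u. j \<in> J \<Longrightarrow> u \<in> U \<Longrightarrow> (\<Sum>i\<in>UNIV. b j i * u $ i) = u $ f j"
      and bV: "\<And>j v. j \<in> J \<Longrightarrow> v \<in> V j \<Longrightarrow> (\<Sum>i\<in>UNIV. b j i * v $ i) = 0"
      by blast
    obtain c :: "'m \<Rightarrow> 'a" where c: "\<And>t. (\<Sum>k\<in>UNIV. c k * veronese e t $ k) =
        (\<Prod>j\<in>J. \<Sum>i\<in>UNIV. b j i * t $ i)"
      using ex_functional_prod_linear_forms[OF J, of e b] e by auto
    \<comment> \<open>On \<open>V j\<close> the factor with index \<open>j\<close> is zero, and so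
      is the whole product.\<close>
    have "(\<Sum>k\<in>UNIV. c k * x $ k) = (\<Sum>k\<in>UNIV. 0 * x $ k)"
      if "x \<in> (\<Union>j\<in>J. veronese_span e (V j))" for x
    proof -
      from that obtain j where j: "j \<in> J" "x \<in> vec.span (veronese e ` V j)"
        by (auto simp: veronese_span_def)
      show ?thesis
        using j(2)
      proof (rule functional_eq_on_span)
        fix y assume "y \<in> veronese e ` V j"
        then show "(\<Sum>k\<in>UNIV. c k * y $ k) = (\<Sum>k\<in>UNIV. 0 * y $ k)"
          using c J by (auto intro!: bexI[OF _ j(1)] simp: bV[OF j(1)])
      qed
    qed
    from functional_eq_on_span[OF w(2) this] have "(\<Sum>k\<in>UNIV. c k * w $ k) = 0"
      by simp
    \<comment> \<open>The right side is coordinate \<open>k\<close> written as a functional. On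
      \<open>U\<close> the product of forms is the product of the coordinates \<open>f j\<close>,
      that is, the monomial of \<open>k\<close>.\<close>
    moreover have "(\<Sum>k\<in>UNIV. c k * w $ k) = (\<Sum>l\<in>UNIV. of_bool (l = k) * w $ l)"
      using w(1) unfolding veronese_span_def
    proof (rule functional_eq_on_span)
      fix x assume "x \<in> veronese e ` U"
      then show "(\<Sum>k\<in>UNIV. c k * x $ k) = (\<Sum>l\<in>UNIV. of_bool (l = k) * x $ l)"
        using c bU by (auto simp: f of_bool_def if_distrib[of "\<lambda>x. x * _"] cong: if_cong)
    qed
    ultimately show ?thesis
      by (simp add: of_bool_def if_distrib[of "\<lambda>x. x * _"] cong: if_cong)
  qed
  then show ?thesis
    by (simp add: vec_eq_iff)
qed

section \<open>Direct sums\<close>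

lemma is_direct_sumI:
  fixes W :: "'i \<Rightarrow> ('a::field ^ 'm::finite) set"
  assumes I: "finite I" and W: "\<And>i. i \<in> I \<Longrightarrow> vec.subspace (W i)"
    and triv: "\<And>i w. i \<in> I \<Longrightarrow> w \<in> W i \<Longrightarrow> w \<in> vec.span (\<Union>j\<in>I - {i}. W j) \<Longrightarrow> w = 0"
  shows "is_direct_sum I W (vec.span (\<Union>i\<in>I. W i))"
  unfolding is_direct_sum_def bij_betw_def
proof (intro conjI I)
  show "inj_on (\<lambda>w. \<Sum>i\<in>I. w i) (\<Pi>\<^sub>E i\<in>I. W i)"
  proof (rule inj_onI)
    fix x y assume x: "x \<in> (\<Pi>\<^sub>E i\<in>I. W i)" and y: "y \<in> (\<Pi>\<^sub>E i\<in>I. W i)"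
      and eq: "(\<Sum>i\<in>I. x i) = (\<Sum>i\<in>I. y i)"
    have "x i = y i" if i: "i \<in> I" for i
    proof -
      have "x i - y i \<in> W i"
        using x y i W by (intro vec.subspace_diff) auto
      \<comment> \<open>Isolating the \<open>i\<close>-th term of two equal sums puts the difference
        into both \<open>W i\<close> and the span of the other summands.\<close>
      moreover have "x i - y i = (\<Sum>j\<in>I - {i}. y j - x j)"
        using eq by (simp add: sum_subtractf sum.remove[OF I i] algebra_simps)
      moreover have "(\<Sum>j\<in>I - {i}. y j - x j) \<in> vec.span (\<Union>j\<in>I - {i}. W j)"
        using x y W
        by (intro vec.span_sum vec.span_base) (blast intro: vec.subspace_diff PiE_mem)
      ultimately have "x i - y i = 0"
        using triv[OF i] by metis
      then show ?thesis by simp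
    qed
    then show "x = y"
      using x y by (rule PiE_ext[rotated 2])
  qed
  show "(\<lambda>w. \<Sum>i\<in>I. w i) ` (\<Pi>\<^sub>E i\<in>I. W i) = vec.span (\<Union>i\<in>I. W i)" (is "?S = ?T")
  proof
    show "?S \<subseteq> ?T"
      by (auto intro!: vec.span_sum intro: vec.span_base)
    \<comment> \<open>The set of sums will be shown to be a subspace containing every
      \<open>W i\<close>, hence the span. Restricting \<open>w\<close> to \<open>I\<close> makes it
      a member of the extensional product.\<close>
    have mem: "(\<Sum>i\<in>I. w i) \<in> ?S" if "\<And>i. i \<in> I \<Longrightarrow> w i \<in> W i" for w
      using that by (intro image_eqI[of _ _ "restrict w I"]) auto
    have "vec.subspace ?S"
      unfolding vec.subspace_def
    proof (intro conjI allI ballI)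
      show "0 \<in> ?S"
        using mem[of "\<lambda>_. 0"] W by (simp add: vec.subspace_0)
    next
      fix u v assume "u \<in> ?S" "v \<in> ?S"
      then obtain x y where x: "x \<in> (\<Pi>\<^sub>E i\<in>I. W i)" "u = (\<Sum>i\<in>I. x i)"
        and y: "y \<in> (\<Pi>\<^sub>E i\<in>I. W i)" "v = (\<Sum>i\<in>I. y i)" by blast
      have "(\<Sum>i\<in>I. x i + y i) \<in> ?S"
        using x(1) y(1) W by (intro mem vec.subspace_add) auto
      then show "u + v \<in> ?S"
        by (simp add: x y sum.distrib)
    next
      fix a u assume "u \<in> ?S"
      then obtain x where x: "x \<in> (\<Pi>\<^sub>E i\<in>I. W i)" "u = (\<Sum>i\<in>I. x i)" by blast
      have "(\<Sum>i\<in>I. a *s x i) \<in> ?S"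
        using x(1) W by (intro mem vec.subspace_scale) auto
      then show "a *s u \<in> ?S"
        by (simp add: x vec.scale_sum_right)
    qed
    moreover have "(\<Union>i\<in>I. W i) \<subseteq> ?S"
    proof
      fix u assume "u \<in> (\<Union>i\<in>I. W i)"
      then obtain i where i: "i \<in> I" "u \<in> W i" by blast
      have "(\<Sum>j\<in>I. if j = i then u else 0) \<in> ?S"
        using i W by (intro mem) (auto simp: vec.subspace_0)
      then show "u \<in> ?S"
        using i I by simp
    qed
    ultimately show "?T \<subseteq> ?S"
      by (rule vec.span_minimal[rotated])
  qed
qed

text \<open>Removing one index from \<open>I\<close> leaves \<open>d\<close> subspaces, one for each
  factor of a monomial of degree \<open>d\<close>. A general index type covers both tuples and sets
  of spans.\<close>

lemma is_direct_sum_veronese_span: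
  fixes e :: "'m::finite \<Rightarrow> 'n::finite \<Rightarrow> nat" and U :: "'i \<Rightarrow> ('a::field ^ 'n) set"
  assumes I: "finite I" "card I = d + 1" and e: "range e = exponents d"
    and U: "\<And>i. i \<in> I \<Longrightarrow> vec.subspace (U i)"
    and disj: "\<And>i j. i \<in> I \<Longrightarrow> j \<in> I \<Longrightarrow> i \<noteq> j \<Longrightarrow> U i \<inter> U j = {0}"
  shows "is_direct_sum I (\<lambda>i. veronese_span e (U i))
    (vec.span (\<Union>i\<in>I. veronese_span e (U i)))"
proof (rule is_direct_sumI)
  fix i w assume "i \<in> I" "w \<in> veronese_span e (U i)"
    "w \<in> vec.span (\<Union>j\<in>I - {i}. veronese_span e (U j))"
  then show "w = 0"
    using I e U by (intro veronese_span_inter_trivial[of "I - {i}" e "U i" U w] disj) auto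
qed (auto simp: I veronese_span_def)

text \<open>If distinct \<open>U\<close> and \<open>V\<close> had the same span, the image of a
  nonzero \<open>u\<close> in \<open>U\<close> would lie in the span for \<open>V\<close> too.
  Taking \<open>V\<close> as all \<open>d\<close> subspaces in
  \<open>veronese_span_inter_trivial\<close> makes this image zero, although a nonzero coordinate of
  \<open>u\<close> has a nonzero \<open>d\<close>-th power.\<close>

lemma inj_on_veronese_span:
  fixes e :: "'m::finite \<Rightarrow> 'n::finite \<Rightarrow> nat" and \<U> :: "('a::field ^ 'n) set set"
  assumes e: "range e = exponents d"
    and U: "\<And>U. U \<in> \<U> \<Longrightarrow> vec.subspace U \<and> U \<noteq> {0}"
    and disj: "\<And>U V. U \<in> \<U> \<Longrightarrow> V \<in> \<U> \<Longrightarrow> U \<noteq> V \<Longrightarrow> U \<inter> V = {0}"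
    and "d > 0"
  shows "inj_on (veronese_span e) \<U>"
proof (rule inj_onI, rule ccontr)
  fix U V assume UV: "U \<in> \<U>" "V \<in> \<U>" "veronese_span e U = veronese_span e V" "U \<noteq> V"
  obtain u where u: "u \<in> U" "u \<noteq> 0"
    using assms(2)[OF UV(1)] vec.subspace_0 by blast
  then obtain i where i: "u $ i \<noteq> 0"
    by (auto simp: vec_eq_iff)
  obtain k where k: "\<And>t :: 'a ^ 'n. veronese e t $ k = t $ i ^ d"
    using veronese_prod_coordinates[of "{..<d}" e "\<lambda>_. i"] e by auto
  have mem: "veronese e u \<in> veronese_span e U"
    using u by (auto simp: veronese_span_def intro: vec.span_base)
  have "veronese e u = 0"
  proof (rule veronese_span_inter_trivial[of "{..<d}" e U "\<lambda>_. V"])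
    show "veronese e u \<in> vec.span (\<Union>j\<in>{..<d}. veronese_span e V)"
      using mem UV(3) \<open>d > 0\<close> by (intro vec.span_base) auto
  qed (use UV assms mem in auto)
  then show False
    using k[of u] i by simp
qed

theorem theorem2p2:
  fixes d :: nat
    and e :: "'m::finite \<Rightarrow> 'n::finite \<Rightarrow> nat"
    and \<U> :: "('a::field ^ 'n) set set"
  assumes "d > 1" and "CARD('n) > 1"
    and "CARD('m) = (d + CARD('n) - 1) choose d"
    and "bij_betw e UNIV (exponents d)"
    and "at_least (d + 1) \<U>"
    and "\<And>U. U \<in> \<U> \<Longrightarrow> vec.subspace U \<and> U \<noteq> {0}"
    and "\<And>U V. U \<in> \<U> \<Longrightarrow> V \<in> \<U> \<Longrightarrow> U \<noteq> V \<Longrightarrow> U \<inter> V = {0}"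
  shows "k_independent (d + 1) {veronese_span e U | U. U \<in> \<U>} \<and>
    (\<forall>U :: nat \<Rightarrow> ('a ^ 'n) set. inj_on U {0..d} \<and> U ` {0..d} \<subseteq> \<U> \<longrightarrow>
       is_direct_sum {0..d} (\<lambda>i. veronese_span e (U i))
         (vec.span (\<Union>i\<in>{0..d}. veronese_span e (U i))))"
proof (intro conjI allI impI)
  have e: "range e = exponents d"
    using assms(4) by (simp add: bij_betw_def)
  show "is_direct_sum {0..d} (\<lambda>i. veronese_span e (U i))
      (vec.span (\<Union>i\<in>{0..d}. veronese_span e (U i)))"
    if "inj_on U {0..d} \<and> U ` {0..d} \<subseteq> \<U>" for U :: "nat \<Rightarrow> ('a ^ 'n) set"
  proof (rule is_direct_sum_veronese_span[OF _ _ e])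
    show "U i \<inter> U j = {0}" if "i \<in> {0..d}" "j \<in> {0..d}" "i \<noteq> j" for i j
      using that \<open>inj_on U {0..d} \<and> U ` {0..d} \<subseteq> \<U>\<close> by (intro assms(7)) (auto dest: inj_onD)
    show "vec.subspace (U i)" if "i \<in> {0..d}" for i
      using that \<open>inj_on U {0..d} \<and> U ` {0..d} \<subseteq> \<U>\<close> assms(6) by blast
  qed auto
  let ?S = "{veronese_span e U | U. U \<in> \<U>}"
  have S: "?S = veronese_span e ` \<U>"
    by blast
  have inj: "inj_on (veronese_span e) \<U>"
    using assms(1) by (intro inj_on_veronese_span[OF e assms(6,7)]) auto
  show "k_independent (d + 1) ?S"
    unfolding k_independent_def S
  proof (intro conjI allI impI ballI)
    show "vec.subspace W" if "W \<in> veronese_span e ` \<U>" for W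
      using that by (auto simp: veronese_span_def)
    \<comment> \<open>By injectivity no members are lost on passing to spans, whether \<U> is finite
      or infinite.\<close>
    show "at_least (d + 1) (veronese_span e ` \<U>)"
      using assms(5) inj by (simp add: at_least_def card_image finite_image_iff)
    fix F assume F: "F \<subseteq> veronese_span e ` \<U>" "finite F \<and> card F = d + 1"
    \<comment> \<open>Indexing by the spans themselves turns the set \<open>F\<close> into a family:
      distinct \<open>W\<close> in \<open>F\<close> have distinct preimages \<open>U W\<close>,
      which therefore meet in zero.\<close>
    define U where "U = inv_into \<U> (veronese_span e)"
    have U: "U W \<in> \<U>" "veronese_span e (U W) = W" if "W \<in> F" for W
      using that F(1) by (auto simp: U_def inv_into_into f_inv_into_f)
    have "is_direct_sum F (\<lambda>W. veronese_span e (U W))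
        (vec.span (\<Union>W\<in>F. veronese_span e (U W)))"
    proof (rule is_direct_sum_veronese_span[OF _ _ e])
      show "U W \<inter> U W' = {0}" if "W \<in> F" "W' \<in> F" "W \<noteq> W'" for W W'
        using that U by (intro assms(7)) metis+
    qed (use F U assms(6) in auto)
    moreover have "(\<Union>W\<in>F. veronese_span e (U W)) = \<Union>F"
      using U by auto
    moreover have "(\<Pi>\<^sub>E W\<in>F. veronese_span e (U W)) = (\<Pi>\<^sub>E W\<in>F. W)"
      using U by (intro PiE_cong) auto
    ultimately show "is_direct_sum F (\<lambda>W. W) (vec.span (\<Union>F))"
      by (simp add: is_direct_sum_def)
  qed
qed

end
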